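(* Let $0<q<p\le 1$ and let $\phi$ be analytic in $\mathbb{U}$ with $\Re(\phi(z))>0$ for $z\in\mathbb{U}$, $\phi(0)=1$, $\phi'(0)>0$, and $\phi(z)=1+b_1z+b_2z^2+\cdots$ with real coefficients, $b_1>0$ and $b_2\ge 0$. Let $$\rho_1=\frac{[2]_{p,q}^2([2]_{p,q}-1)b_1^2+\big([2]_{p,q}([2]_{p,q}-1)\big)^2(b_2-b_1)}{[3]_{p,q}([3]_{p,q}-1)b_1^2},$$ $$\rho_2=\frac{[2]_{p,q}^2([2]_{p,q}-1)b_1^2+\big([2]_{p,q}([2]_{p,q}-1)\big)^2(b_2+b_1)}{[3]_{p,q}([3]_{p,q}-1)b_1^2},$$ $$\rho_3=\frac{[2]_{p,q}^2([2]_{p,q}-1)b_1^2+\big([2]_{p,q}([2]_{p,q}-1)\big)^2b_2}{[3]_{p,q}([3]_{p,q}-1)b_1^2}.$$ Let $\mu\in\mathbb{R}$. If $f(z)=z+\sum_{n=2}^{\infty}a_nz^n$ belongs to the class $\mathcal{C}_{p,q}(\phi)$, then $$|a_3-\mu a_2^2|\le\begin{cases}\dfrac{b_2}{[3]_{p,q}([3]_{p,q}-1)}+\dfrac{b_1^2}{[2]_{p,q}-1}\left(\dfrac{1}{[3]_{p,q}([3]_{p,q}-1)}-\dfrac{\mu}{[2]_{p,q}^2([2]_{p,q}-1)}\right), & \text{if }\mu\le\rho_1,\\[2mm] \dfrac{b_1}{[3]_{p,q}([3]_{p,q}-1)}, & \text{if }\rho_1\le\mu\le\rho_2,\\[2mm]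 \dfrac{-b_2}{[3]_{p,q}([3]_{p,q}-1)}-\dfrac{b_1^2}{[2]_{p,q}-1}\left(\dfrac{1}{[3]_{p,q}([3]_{p,q}-1)}-\dfrac{\mu}{[2]_{p,q}^2([2]_{p,q}-1)}\right), & \text{if }\mu\ge\rho_2.\end{cases}$$ Further, if $\rho_1<\mu\le\rho_3$, then $$|a_3-\mu a_2^2|+\frac{[2]_{p,q}^2([2]_{p,q}-1)^2}{[3]_{p,q}([3]_{p,q}-1)b_1^2}\left[b_1-b_2-\frac{b_1^2}{[2]_{p,q}-1}\left(1-\frac{[3]_{p,q}([3]_{p,q}-1)}{[2]_{p,q}^2([2]_{p,q}-1)}\mu\right)\right]|a_2|^2\le\frac{b_1}{[3]_{p,q}([3]_{p,q}-1)},$$ and if $\rho_3\le\mu<\rho_2$, then $$|a_3-\mu a_2^2|+\frac{[2]_{p,q}^2([2]_{p,q}-1)^2}{[3]_{p,q}([3]_{p,q}-1)b_1^2}\left[b_1+b_2+\frac{b_1^2}{[2]_{p,q}-1}\left(1-\frac{[3]_{p,q}([3]_{p,q}-1)}{[2]_{p,q}^2([2]_{p,q}-1)}\mu\right)\right]|a_2|^2\le\frac{b_1}{[3]_{p,q}([3]_{p,q}-1)}.$$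
   Context: $\mathbb{U}=\{z\in\mathbb{C}:|z|<1\}$. $\mathcal{A}$ is the class of functions $f(z)=z+\sum_{n=2}^{\infty}a_nz^n$ analytic in $\mathbb{U}$. For $0<q<p\le1$, $[n]_{p,q}=\frac{p^n-q^n}{p-q}$. The $(p,q)$-derivative is $D_{p,q}f(z)=\frac{f(pz)-f(qz)}{(p-q)z}$ for $z\ne0$; for $f\in\mathcal{A}$ this is $D_{p,q}f(z)=1+\sum_{n=2}^{\infty}[n]_{p,q}a_nz^{n-1}$ (which also gives the value at $z=0$), and $D_{p,q}(zD_{p,q}f(z))=1+\sum_{n=2}^{\infty}[n]_{p,q}^2a_nz^{n-1}$. For $g,F$ analytic in $\mathbb{U}$, $g$ is subordinate to $F$, written $g\prec F$, if there is a Schwarz function $w$, i.e. $w$ analytic in $\mathbb{U}$ with $w(0)=0$ and $|w(z)|<1$, such that $g(z)=F(w(z))$ for all $z\in\mathbb{U}$. For $\phi$ analytic in $\mathbb{U}$ with $\Re(\phi(z))>0$, $\phi(0)=1$, $\phi'(0)>0$, the class $\mathcal{C}_{p,q}(\phi)$ of $(p,q)$-convex functions consists of all $f\in\mathcal{A}$ with $\frac{D_{p,q}(zD_{p,q}f(z))}{D_{p,q}f(z)}\prec\phi(z)$.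
   Formalization: The formal theorem also assumes [3]_{p,q} > 1 (which implies [2]_{p,q} > 1); for [3]_{p,q} < 1 the claim fails for f(z)=z at μ=ρ_1 (negative bound), and for [3]_{p,q}=1 or [2]_{p,q}=1 the formulas divide by zero. *)

theory Defs
  imports "HOL-Complex_Analysis.Complex_Analysis"
begin

abbreviation unit_disc :: "complex set"
  where "unit_disc \<equiv> ball 0 1"

definition pq_num :: "real \<Rightarrow> real \<Rightarrow> nat \<Rightarrow> real"
  where "pq_num p q n = (p ^ n - q ^ n) / (p - q)"

text \<open>For \<open>0 < q < p \<le> 1\<close> these numbers need not exceed \<open>1\<close>: for instance
  \<open>pq_num p q 2 = p + q\<close> and \<open>pq_num p q 3 = p\<^sup>2 + p q + q\<^sup>2\<close>. The Fekete--Szego bounds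
  divide by \<open>pq_num p q 2 - 1\<close> and \<open>pq_num p q 3 - 1\<close> and fail for \<open>f(z) = z\<close> when the
  latter is negative, so \<open>pq_num p q 3 > 1\<close> has to be assumed there (it implies
  \<open>pq_num p q 2 > 1\<close>, and it is automatic for \<open>p = 1\<close>).\<close>

text \<open>The value at \<open>0\<close> is the limit of the difference quotient for \<open>f\<close> analytic at \<open>0\<close>;
  it is \<open>1\<close> for \<open>f(z) = z + a\<^sub>2 z\<^sup>2 + \<dots>\<close>.\<close>

definition pq_deriv :: "real \<Rightarrow> real \<Rightarrow> (complex \<Rightarrow> complex) \<Rightarrow> complex \<Rightarrow> complex"
  where "pq_deriv p q f z =
    (if z = 0 then deriv f 0
     else (f (of_real p * z) - f (of_real q * z)) / (of_real (p - q) * z))"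

text \<open>Only the coefficients \<open>a n\<close> with \<open>n \<ge> 2\<close> are constrained.\<close>

definition normalized_expansion :: "(complex \<Rightarrow> complex) \<Rightarrow> (nat \<Rightarrow> complex) \<Rightarrow> bool"
  where "normalized_expansion f a \<longleftrightarrow>
    (\<forall>z\<in>unit_disc. (\<lambda>n. a (n + 2) * z ^ (n + 2)) sums (f z - z))"

definition class_A :: "(complex \<Rightarrow> complex) set"
  where "class_A = {f. f holomorphic_on unit_disc \<and> (\<exists>a. normalized_expansion f a)}"

definition schwarz_function :: "(complex \<Rightarrow> complex) \<Rightarrow> bool"
  where "schwarz_function w \<longleftrightarrow>
    w holomorphic_on unit_disc \<and> w 0 = 0 \<and> (\<forall>z\<in>unit_disc. norm (w z) < 1)"

definition subordinate :: "(complex \<Rightarrow> complex) \<Rightarrow> (complex \<Rightarrow> complex) \<Rightarrow> bool"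
    (infix \<open>\<prec>\<^sub>s\<close> 50)
  where "g \<prec>\<^sub>s F \<longleftrightarrow>
    g holomorphic_on unit_disc \<and> F holomorphic_on unit_disc \<and>
    (\<exists>w. schwarz_function w \<and> (\<forall>z\<in>unit_disc. g z = F (w z)))"

definition admissible :: "(complex \<Rightarrow> complex) \<Rightarrow> bool"
  where "admissible \<phi> \<longleftrightarrow>
    \<phi> holomorphic_on unit_disc \<and> (\<forall>z\<in>unit_disc. Re (\<phi> z) > 0) \<and> \<phi> 0 = 1 \<and>
    deriv \<phi> 0 \<in> \<real> \<and> Re (deriv \<phi> 0) > 0"

text \<open>For admissible \<open>\<phi>\<close>, the denominator of the quotient cannot vanish in the disc:
  with \<open>x / 0 = 0\<close> the quotient would be \<open>0\<close> there, but \<open>\<phi>\<close> has positive real part.\<close>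

definition pq_convex :: "real \<Rightarrow> real \<Rightarrow> (complex \<Rightarrow> complex) \<Rightarrow> (complex \<Rightarrow> complex) set"
  where "pq_convex p q \<phi> =
    {f \<in> class_A. (\<lambda>z. pq_deriv p q (\<lambda>u. u * pq_deriv p q f u) z / pq_deriv p q f z) \<prec>\<^sub>s \<phi>}"

end

theory Submission imports Defs begin

text \<open>Write \<open>w(z) = w\<^sub>1 z + w\<^sub>2 z\<^sup>2 + \<dots>\<close> for the Schwarz function of the subordination and
  \<open>N\<^sub>k = [k]\<^bsub>p,q\<^esub>\<close>. Comparing coefficients in \<open>D(z D f) = (\<phi> \<circ> w) \<cdot> D f\<close> gives
  \<open>N\<^sub>2 (N\<^sub>2 - 1) a\<^sub>2 = b\<^sub>1 w\<^sub>1\<close> and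
  \<open>N\<^sub>3 (N\<^sub>3 - 1) a\<^sub>3 = b\<^sub>1 w\<^sub>2 + b\<^sub>2 w\<^sub>1\<^sup>2 + b\<^sub>1\<^sup>2 w\<^sub>1\<^sup>2 / (N\<^sub>2 - 1)\<close>, so that
  \<open>N\<^sub>3 (N\<^sub>3 - 1) (a\<^sub>3 - \<mu> a\<^sub>2\<^sup>2) = b\<^sub>1 w\<^sub>2 + T w\<^sub>1\<^sup>2\<close> for a real number \<open>T\<close> which is affine and decreasing
  in \<open>\<mu>\<close> and equals \<open>b\<^sub>1\<close>, \<open>0\<close>, \<open>- b\<^sub>1\<close> at \<open>\<rho>\<^sub>1\<close>, \<open>\<rho>\<^sub>3\<close>, \<open>\<rho>\<^sub>2\<close>. The Schwarz--Pick bound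
  \<open>\<bar>w\<^sub>2\<bar> \<le> 1 - \<bar>w\<^sub>1\<bar>\<^sup>2\<close> turns this into
  \<open>N\<^sub>3 (N\<^sub>3 - 1) \<bar>a\<^sub>3 - \<mu> a\<^sub>2\<^sup>2\<bar> \<le> b\<^sub>1 (1 - \<bar>w\<^sub>1\<bar>\<^sup>2) + \<bar>T\<bar> \<bar>w\<^sub>1\<bar>\<^sup>2\<close>, which contains all five estimates.\<close>

lemma has_fps_expansion_Abs_fps:
  fixes f :: "complex \<Rightarrow> complex"
  assumes "\<forall>z\<in>unit_disc. (\<lambda>n. c n * z ^ n) sums f z"
  shows "f has_fps_expansion Abs_fps c"
proof (rule has_fps_expansionI)
  have "eventually (\<lambda>u::complex. u \<in> unit_disc) (nhds 0)"
    by (intro eventually_nhds_in_open) auto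
  then show "eventually (\<lambda>u. (\<lambda>n. fps_nth (Abs_fps c) n * u ^ n) sums f u) (nhds 0)"
    by eventually_elim (use assms in auto)
qed

section \<open>Coefficient bounds for Schwarz functions\<close>

text \<open>The Moebius map sending \<open>g 0\<close> to 0 turns \<open>g\<close> into a self-map
  \<open>F\<close> of the disc fixing 0. The Schwarz lemma bounds the derivative of \<open>F\<close>
  at 0, which by the chain rule is that of \<open>g\<close> divided by 1 - |g(0)|^2.\<close>

lemma schwarz_pick_deriv_0:
  assumes holg: "g holomorphic_on unit_disc"
    and g: "\<And>z. z \<in> unit_disc \<Longrightarrow> norm (g z) < 1"
  shows "norm (deriv g 0) \<le> 1 - (norm (g 0))\<^sup>2"
proof -
  define c where "c = g 0"
  have c: "norm c < 1"
    using g[of 0] by (simp add: c_def)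
  let ?m = "Moebius_function 0 c"
  define F where "F = ?m \<circ> g"
  have "F holomorphic_on unit_disc"
    unfolding F_def using g
    by (intro holomorphic_on_compose_gen[OF holg Moebius_function_holomorphic[OF c]]) auto
  moreover have "F 0 = 0"
    by (simp add: F_def c_def Moebius_function_eq_zero)
  moreover have "norm (F z) < 1" if "norm z < 1" for z
    using that g[of z] c by (simp add: F_def Moebius_function_norm_lt_1)
  ultimately have F': "norm (deriv F 0) \<le> 1"
    using Schwarz_Lemma(2)[of F 0] by auto
  have cc: "cnj c * c = of_real ((norm c)\<^sup>2)"
    by (metis complex_norm_square mult.commute of_real_power)
  have pos: "1 - (norm c)\<^sup>2 > 0"
    using c by (simp add: power_less_one_iff abs_square_less_1)
  then have nz: "1 - cnj c * c \<noteq> 0"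
    unfolding cc by (metis of_real_1 of_real_diff of_real_eq_0_iff less_irrefl)
  have dg: "(g has_field_derivative deriv g 0) (at 0)"
    using holg by (intro holomorphic_derivI[of _ unit_disc]) auto
  \<comment> \<open>Quotient rule at \<open>c\<close>: the numerator z - c vanishes there, so only
    one term survives.\<close>
  have "(?m has_field_derivative (1 - cnj c * c) / ((1 - cnj c * c) * (1 - cnj c * c))) (at (g 0))"
    unfolding Moebius_function_simple c_def[symmetric]
    using nz by (auto intro!: derivative_eq_intros)
  then have "(?m has_field_derivative 1 / (1 - cnj c * c)) (at (g 0))"
    by (metis nz divide_divide_eq_left divide_self)
  then have "(F has_field_derivative 1 / (1 - cnj c * c) * deriv g 0) (at 0)"
    unfolding F_def using dg by (rule DERIV_chain)
  then have "deriv F 0 = deriv g 0 / (1 - cnj c * c)"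
    by (simp add: DERIV_imp_deriv)
  also have "1 - cnj c * c = of_real (1 - (norm c)\<^sup>2)"
    by (simp add: cc)
  finally have "norm (deriv F 0) = norm (deriv g 0) / (1 - (norm c)\<^sup>2)"
    using pos by (simp only: norm_divide norm_of_real)
  with F' pos show ?thesis
    by (simp add: c_def divide_simps)
qed

text \<open>The quotient g(z) = w(z)/z has value w_1 and derivative w_2 at 0, so the second bound is
  Schwarz-Pick for g.\<close>

lemma schwarz_function_coeff_bounds:
  assumes "schwarz_function w" and W: "w has_fps_expansion W"
  shows "norm (fps_nth W 1) \<le> 1" "norm (fps_nth W 2) \<le> 1 - (norm (fps_nth W 1))\<^sup>2"
proof -
  have holw: "w holomorphic_on unit_disc" and w0: "w 0 = 0"
    and w: "\<And>z. norm z < 1 \<Longrightarrow> norm (w z) < 1"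
    using assms by (auto simp: schwarz_function_def)
  note schwarz = Schwarz_Lemma[OF holw w0 w]
  have W1: "fps_nth W 1 = deriv w 0"
    using fps_nth_fps_expansion[OF W, of 1] by simp
  show "norm (fps_nth W 1) \<le> 1"
    unfolding W1 using schwarz(2)[of 0] by simp
  show "norm (fps_nth W 2) \<le> 1 - (norm (fps_nth W 1))\<^sup>2"
  \<comment> \<open>Equality in the Schwarz lemma makes \<open>w\<close> a rotation. Then w(z)/z is
    a unimodular constant, outside the open disc, but w_2 = 0 and |w_1| = 1, so both sides of the
    bound are 0.\<close>
  proof (cases "(\<exists>z. norm z < 1 \<and> z \<noteq> 0 \<and> norm (w z) = norm z) \<or> norm (deriv w 0) = 1")
    case True
    then obtain \<alpha> where \<alpha>: "\<And>z. norm z < 1 \<Longrightarrow> w z = \<alpha> * z" "norm \<alpha> = 1"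
      using schwarz(3)[of 0] by auto
    have "\<forall>z\<in>unit_disc. (\<lambda>n. (if n = 1 then \<alpha> else 0) * z ^ n) sums w z"
    proof
      fix z assume "z \<in> unit_disc"
      then show "(\<lambda>n. (if n = 1 then \<alpha> else 0) * z ^ n) sums w z"
        using sums_single[of 1 "\<lambda>n. \<alpha> * z ^ n"] \<alpha>(1)[of z]
        by (simp add: if_distrib[where f = "\<lambda>x. x * z ^ _"] cong: if_cong)
    qed
    from fps_expansion_unique_complex[OF W has_fps_expansion_Abs_fps[OF this]]
    show ?thesis
      by (simp add: \<alpha>(2))
  next
    case False
    obtain g where holg: "g holomorphic_on unit_disc"
      and g: "\<And>z. norm z < 1 \<Longrightarrow> w z = z * g z" and g0: "deriv w 0 = g 0"
      by (rule Schwarz3[OF holw w0]) auto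
    have "norm (g z) < 1" if "z \<in> unit_disc" for z
    proof (cases "z = 0")
      case True
      then show ?thesis
        using False schwarz(2)[of 0] g0 by auto
    next
      case z: False
      then have "norm (w z) < norm z"
        using False schwarz(1)[of z] that by (auto simp: order.strict_iff_order)
      with z g[of z] that show ?thesis
        by (simp add: norm_mult)
    qed
    from schwarz_pick_deriv_0[OF holg this]
    have le: "norm (deriv g 0) \<le> 1 - (norm (g 0))\<^sup>2" .
    have G: "g has_fps_expansion fps_expansion g 0"
      using holg by (intro has_fps_expansion_fps_expansion[of unit_disc]) auto
    have "(\<lambda>z. z * g z) has_fps_expansion fps_X * fps_expansion g 0"
      by (intro fps_expansion_intros G)
    moreover have "eventually (\<lambda>z. z \<in> unit_disc) (nhds 0)"
      by (intro eventually_nhds_in_open) auto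
    then have "eventually (\<lambda>z. z * g z = w z) (nhds 0)"
      by eventually_elim (use g in auto)
    note has_fps_expansion_cong[OF this refl]
    ultimately have "w has_fps_expansion fps_X * fps_expansion g 0"
      by simp
    from fps_expansion_unique_complex[OF W this]
    have "fps_nth W 2 = fps_nth (fps_expansion g 0) 1"
      by simp
    also have "\<dots> = deriv g 0"
      using fps_nth_fps_expansion[OF G, of 1] by simp
    finally show ?thesis
      using le g0 W1 by simp
  qed
qed

section \<open>Power series of the (p,q)-derivative\<close>

text \<open>Termwise, ((pz)^n - (qz)^n) / ((p - q)z) = [n] z^(n-1). Arbitrary coefficients allow a
  second application, to z D f.\<close>

lemma sums_pq_deriv:
  assumes pq: "0 < q" "q < p" "p \<le> 1"
    and f: "\<forall>z\<in>unit_disc. (\<lambda>n. c n * z ^ n) sums f z"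
  shows "\<forall>z\<in>unit_disc. (\<lambda>n. of_real (pq_num p q (Suc n)) * c (Suc n) * z ^ n) sums pq_deriv p q f z"
proof
  fix z :: complex assume z: "z \<in> unit_disc"
  show "(\<lambda>n. of_real (pq_num p q (Suc n)) * c (Suc n) * z ^ n) sums pq_deriv p q f z"
  proof (cases "z = 0")
    case True
    have "deriv f 0 = c 1"
      using fps_nth_fps_expansion[OF has_fps_expansion_Abs_fps[OF f], of 1] by simp
    with True pq show ?thesis
      using powser_sums_zero[of "\<lambda>n. of_real (pq_num p q (Suc n)) * c (Suc n)"]
      by (simp add: pq_deriv_def pq_num_def)
  next
    case False
    have in_disc: "of_real r * z \<in> unit_disc" if "0 < r" "r \<le> 1" for r
      using that z mult_right_le_one_le[of "norm z" r]
      by (simp add: norm_mult mult.commute)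
    define h where "h n = c n * (of_real p * z) ^ n - c n * (of_real q * z) ^ n" for n
    have "h sums (f (of_real p * z) - f (of_real q * z))"
      unfolding h_def using f pq in_disc[of p] in_disc[of q] by (intro sums_diff) auto
    \<comment> \<open>The constant terms cancel, which permits the index shift that makes division
      by z harmless.\<close>
    moreover have "h 0 = 0"
      by (simp add: h_def)
    ultimately have "(\<lambda>n. h (Suc n)) sums (f (of_real p * z) - f (of_real q * z))"
      by (simp add: sums_Suc_iff)
    from sums_divide[OF this, of "of_real (p - q) * z"]
    have "(\<lambda>n. h (Suc n) / (of_real (p - q) * z)) sums pq_deriv p q f z"
      using False by (simp add: pq_deriv_def)
    moreover have "h (Suc n) / (of_real (p - q) * z) = of_real (pq_num p q (Suc n)) * c (Suc n) * z ^ n" for n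
    proof -
      have "complex_of_real p - of_real q \<noteq> 0"
        using pq by simp
      then show ?thesis
        using False by (simp add: h_def pq_num_def power_mult_distrib divide_simps) (simp add: algebra_simps)
    qed
    ultimately show ?thesis
      by simp
  qed
qed

lemma sums_mult_var:
  fixes g :: "complex \<Rightarrow> complex"
  assumes "\<forall>z\<in>A. (\<lambda>n. c n * z ^ n) sums g z"
  shows "\<forall>z\<in>A. (\<lambda>n. (case n of 0 \<Rightarrow> 0 | Suc m \<Rightarrow> c m) * z ^ n) sums (z * g z)"
proof
  fix z assume "z \<in> A"
  with assms have "(\<lambda>n. z * (c n * z ^ n)) sums (z * g z)"
    by (intro sums_mult) auto
  then have "(\<lambda>n. (case Suc n of 0 \<Rightarrow> 0 | Suc m \<Rightarrow> c m) * z ^ Suc n) sums (z * g z)"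
    by (simp add: mult_ac)
  then show "(\<lambda>n. (case n of 0 \<Rightarrow> 0 | Suc m \<Rightarrow> c m) * z ^ n) sums (z * g z)"
    by (subst (asm) sums_Suc_iff) simp
qed

section \<open>Comparison of coefficients in the subordination\<close>

text \<open>The equation for \<open>a 3\<close> still contains \<open>a 2\<close>: eliminating it
  would divide by [2] - 1 = p + q - 1, which can be 0 under these hypotheses.\<close>

lemma pq_convex_coeffs:
  assumes pq: "0 < q" "q < p" "p \<le> 1"
    and phi: "admissible \<phi>"
    and phi_expansion: "\<forall>z\<in>unit_disc. (\<lambda>n. of_real (b n) * z ^ n) sums \<phi> z"
    and f: "f \<in> pq_convex p q \<phi>"
    and f_expansion: "normalized_expansion f a"
  obtains w1 w2 :: complex where
    "norm w1 \<le> 1" "norm w2 \<le> 1 - (norm w1)\<^sup>2"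
    "of_real (pq_num p q 2 * (pq_num p q 2 - 1)) * a 2 = of_real (b 1) * w1"
    "of_real (pq_num p q 3 * (pq_num p q 3 - 1)) * a 3 =
       of_real (b 1) * w2 + of_real (b 2) * w1\<^sup>2
       + of_real (b 1) * w1 * of_real (pq_num p q 2) * a 2"
proof -
  \<comment> \<open>\<open>normalized_expansion\<close> says nothing about \<open>a 0\<close> and
    \<open>a 1\<close>; \<open>c\<close> supplies the true values 0 and 1.\<close>
  define c where "c n = (if n = 0 then 0 else if n = 1 then 1 else a n)" for n
  let ?N = "\<lambda>n. complex_of_real (pq_num p q n)"
  let ?M = "pq_deriv p q f"
  let ?L = "pq_deriv p q (\<lambda>u. u * ?M u)"
  have f_sums: "\<forall>z\<in>unit_disc. (\<lambda>n. c n * z ^ n) sums f z"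
  proof
    fix z :: complex assume "z \<in> unit_disc"
    then have "(\<lambda>n. c (n + 2) * z ^ (n + 2)) sums (f z - (\<Sum>n<2. c n * z ^ n))"
      using f_expansion by (simp add: normalized_expansion_def c_def eval_nat_numeral)
    then show "(\<lambda>n. c n * z ^ n) sums f z"
      by (subst (asm) sums_iff_shift) simp
  qed
  note M_sums = sums_pq_deriv[OF pq f_sums]
  note L_sums = sums_pq_deriv[OF pq sums_mult_var[OF M_sums]]
  note M = has_fps_expansion_Abs_fps[OF M_sums]
  note L = has_fps_expansion_Abs_fps[OF L_sums]
  note P = has_fps_expansion_Abs_fps[OF phi_expansion]
  obtain w where w: "schwarz_function w"
    and subord: "\<And>z. z \<in> unit_disc \<Longrightarrow> ?L z / ?M z = \<phi> (w z)"
    using f by (auto simp: pq_convex_def subordinate_def)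
  have holw: "w holomorphic_on unit_disc" and w0: "w 0 = 0"
    and w_disc: "\<And>z. z \<in> unit_disc \<Longrightarrow> w z \<in> unit_disc"
    using w by (auto simp: schwarz_function_def)
  define W where "W = fps_expansion w 0"
  have W: "w has_fps_expansion W"
    unfolding W_def using holw by (intro has_fps_expansion_fps_expansion[of unit_disc]) auto
  have W0: "fps_nth W 0 = 0"
    using fps_nth_fps_expansion[OF W, of 0] w0 by simp
  \<comment> \<open>A zero of \<open>?M\<close> would make the quotient 0, against the positive real
    part of \<phi>.\<close>
  have eq: "\<phi> (w z) * ?M z = ?L z" if "z \<in> unit_disc" for z
  proof -
    have "Re (\<phi> (w z)) > 0"
      using phi w_disc[OF that] by (simp add: admissible_def)
    then have "?M z \<noteq> 0"
      using subord[OF that] by auto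
    then show ?thesis
      by (simp add: subord[OF that, symmetric])
  qed
  have "(\<lambda>z. (\<phi> \<circ> w) z * ?M z) has_fps_expansion
      fps_compose (Abs_fps (\<lambda>n. of_real (b n))) W * Abs_fps (\<lambda>n. ?N (Suc n) * c (Suc n))"
    by (intro has_fps_expansion_mult has_fps_expansion_compose P W W0 M)
  moreover have "eventually (\<lambda>z. z \<in> unit_disc) (nhds 0)"
    by (intro eventually_nhds_in_open) auto
  then have "eventually (\<lambda>z. (\<phi> \<circ> w) z * ?M z = ?L z) (nhds 0)"
    by eventually_elim (use eq in auto)
  note has_fps_expansion_cong[OF this refl]
  ultimately have "?L has_fps_expansion
      fps_compose (Abs_fps (\<lambda>n. of_real (b n))) W * Abs_fps (\<lambda>n. ?N (Suc n) * c (Suc n))"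
    by simp
  from fps_expansion_unique_complex[OF L this]
  have coeffs: "?N (Suc n) * (?N (Suc n) * c (Suc n)) =
      (\<Sum>i=0..n. fps_nth (fps_compose (Abs_fps (\<lambda>n. of_real (b n))) W) i
         * (?N (Suc (n - i)) * c (Suc (n - i))))" for n
    by (simp add: fps_eq_iff fps_mult_nth)
  have "\<phi> 0 = 1"
    using phi by (simp add: admissible_def)
  then have b0: "b 0 = 1"
    using fps_nth_fps_expansion[OF P, of 0] by simp
  have N1: "pq_num p q (Suc 0) = 1"
    using pq by (simp add: pq_num_def)
  have comp0: "fps_nth (fps_compose (Abs_fps (\<lambda>n. of_real (b n))) W) 0 = 1"
    by (simp add: b0)
  have comp1: "fps_nth (fps_compose (Abs_fps (\<lambda>n. of_real (b n))) W) 1 = of_real (b 1) * fps_nth W 1"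
    by (simp add: fps_compose_nth)
  \<comment> \<open>As \<open>W\<close> has no constant term, only \<open>W\<close> and
    \<open>W^2\<close> reach degree 2, and \<open>W^2\<close> contributes just w_1^2.\<close>
  have comp2: "fps_nth (fps_compose (Abs_fps (\<lambda>n. of_real (b n))) W) 2
      = of_real (b 1) * fps_nth W 2 + of_real (b 2) * (fps_nth W 1)\<^sup>2"
    by (simp add: fps_compose_nth eval_nat_numeral fps_mult_nth W0)
  have "?N 2 * (?N 2 * a 2) = ?N 2 * a 2 + of_real (b 1) * fps_nth W 1"
    using coeffs[of 1] comp0 comp1
    by (simp add: c_def N1 numeral_2_eq_2)
  moreover have "?N 3 * (?N 3 * a 3) = ?N 3 * a 3 + of_real (b 1) * fps_nth W 1 * (?N 2 * a 2)
      + (of_real (b 1) * fps_nth W 2 + of_real (b 2) * (fps_nth W 1)\<^sup>2)"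
    using coeffs[of 2] comp0 comp1 comp2
    by (simp add: c_def N1 numeral_2_eq_2 numeral_3_eq_3)
  ultimately show thesis
    using schwarz_function_coeff_bounds[OF w W]
    by (intro that[of "fps_nth W 1" "fps_nth W 2"]) (auto simp: algebra_simps)
qed

section \<open>Positive denominators and the Fekete-Szego estimates\<close>

text \<open>Since [2] = p + q and [3] = (p + q)^2 - pq < [2]^2, [3] > 1 forces [2] > 1.\<close>

lemma pq_num_2_gt_1:
  assumes "0 < q" "q < p" "pq_num p q 3 > 1"
  shows "pq_num p q 2 > 1"
proof -
  have "p ^ 3 - q ^ 3 = (p\<^sup>2 + p * q + q\<^sup>2) * (p - q)"
    by (simp add: algebra_simps power2_eq_square power3_eq_cube)
  then have "pq_num p q 3 = p\<^sup>2 + p * q + q\<^sup>2"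
    using assms by (simp add: pq_num_def)
  moreover have "p\<^sup>2 - q\<^sup>2 = (p + q) * (p - q)"
    by (simp add: algebra_simps power2_eq_square)
  then have "pq_num p q 2 = p + q"
    using assms by (simp add: pq_num_def)
  moreover have "p\<^sup>2 + p * q + q\<^sup>2 < (p + q)\<^sup>2"
    using assms by (simp add: power2_sum)
  ultimately show ?thesis
    using assms power_le_one[of "p + q" 2] by (cases "p + q \<le> 1") auto
qed

theorem theorem3p2:
  fixes p q \<mu> :: real
    and \<phi> f :: "complex \<Rightarrow> complex"
    and b :: "nat \<Rightarrow> real"
    and a :: "nat \<Rightarrow> complex"
  assumes pq: "0 < q" "q < p" "p \<le> 1"
    and pq_num_3: "pq_num p q 3 > 1"
    and phi: "admissible \<phi>"
    and phi_expansion: "\<forall>z\<in>unit_disc. (\<lambda>n. of_real (b n) * z ^ n) sums \<phi> z"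
    and b: "b 1 > 0" "b 2 \<ge> 0"
    and f: "f \<in> pq_convex p q \<phi>"
    and f_expansion: "normalized_expansion f a"
  shows
    "let N2 = pq_num p q 2;
         N3 = pq_num p q 3;
         \<rho>1 = (N2\<^sup>2 * (N2 - 1) * (b 1)\<^sup>2 + (N2 * (N2 - 1))\<^sup>2 * (b 2 - b 1))
                / (N3 * (N3 - 1) * (b 1)\<^sup>2);
         \<rho>2 = (N2\<^sup>2 * (N2 - 1) * (b 1)\<^sup>2 + (N2 * (N2 - 1))\<^sup>2 * (b 2 + b 1))
                / (N3 * (N3 - 1) * (b 1)\<^sup>2);
         \<rho>3 = (N2\<^sup>2 * (N2 - 1) * (b 1)\<^sup>2 + (N2 * (N2 - 1))\<^sup>2 * b 2)
                / (N3 * (N3 - 1) * (b 1)\<^sup>2);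
         FS = norm (a 3 - of_real \<mu> * (a 2)\<^sup>2)
     in (\<mu> \<le> \<rho>1 \<longrightarrow>
           FS \<le> b 2 / (N3 * (N3 - 1))
                 + (b 1)\<^sup>2 / (N2 - 1) * (1 / (N3 * (N3 - 1)) - \<mu> / (N2\<^sup>2 * (N2 - 1))))
      \<and> (\<rho>1 \<le> \<mu> \<and> \<mu> \<le> \<rho>2 \<longrightarrow> FS \<le> b 1 / (N3 * (N3 - 1)))
      \<and> (\<mu> \<ge> \<rho>2 \<longrightarrow>
           FS \<le> - b 2 / (N3 * (N3 - 1))
                 - (b 1)\<^sup>2 / (N2 - 1) * (1 / (N3 * (N3 - 1)) - \<mu> / (N2\<^sup>2 * (N2 - 1))))
      \<and> (\<rho>1 < \<mu> \<and> \<mu> \<le> \<rho>3 \<longrightarrow>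
           FS + N2\<^sup>2 * (N2 - 1)\<^sup>2 / (N3 * (N3 - 1) * (b 1)\<^sup>2)
                  * (b 1 - b 2
                     - (b 1)\<^sup>2 / (N2 - 1) * (1 - N3 * (N3 - 1) / (N2\<^sup>2 * (N2 - 1)) * \<mu>))
                  * (norm (a 2))\<^sup>2
             \<le> b 1 / (N3 * (N3 - 1)))
      \<and> (\<rho>3 \<le> \<mu> \<and> \<mu> < \<rho>2 \<longrightarrow>
           FS + N2\<^sup>2 * (N2 - 1)\<^sup>2 / (N3 * (N3 - 1) * (b 1)\<^sup>2)
                  * (b 1 + b 2
                     + (b 1)\<^sup>2 / (N2 - 1) * (1 - N3 * (N3 - 1) / (N2\<^sup>2 * (N2 - 1)) * \<mu>))
                  * (norm (a 2))\<^sup>2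
             \<le> b 1 / (N3 * (N3 - 1)))"
proof -
  define N2 N3 where "N2 = pq_num p q 2" and "N3 = pq_num p q 3"
  have N3: "N3 > 1" and N2: "N2 > 1"
    using pq_num_3 pq_num_2_gt_1[of q p] pq by (auto simp: N2_def N3_def)
  obtain w1 w2 :: complex where w1: "norm w1 \<le> 1" and w2: "norm w2 \<le> 1 - (norm w1)\<^sup>2"
    and a2': "of_real (N2 * (N2 - 1)) * a 2 = of_real (b 1) * w1"
    and a3': "of_real (N3 * (N3 - 1)) * a 3 =
       of_real (b 1) * w2 + of_real (b 2) * w1\<^sup>2 + of_real (b 1) * w1 * of_real N2 * a 2"
    unfolding N2_def N3_def
    using pq_convex_coeffs[OF pq phi phi_expansion f f_expansion] by metis
  define D E where "D = N3 * (N3 - 1)" and "E = N2\<^sup>2 * (N2 - 1)"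
  define T where "T = b 2 + (b 1)\<^sup>2 / (N2 - 1) * (1 - D / E * \<mu>)"
  define x where "x = (norm w1)\<^sup>2"
  have D: "D > 0" and E: "E > 0" and K: "N2 - 1 > 0"
    using N2 N3 by (auto simp: D_def E_def)
  have x: "0 \<le> x" "x \<le> 1"
    using w1 by (auto simp: x_def power_le_one)
  have a2: "a 2 = of_real (b 1 / (N2 * (N2 - 1))) * w1"
  proof -
    have "complex_of_real (N2 * (N2 - 1)) \<noteq> 0"
      using N2 by (subst of_real_eq_0_iff) simp
    then have "a 2 = of_real (b 1) * w1 / of_real (N2 * (N2 - 1))"
      using a2' by (metis nonzero_eq_divide_eq mult.commute)
    then show ?thesis
      by simp
  qed
  have N2c: "complex_of_real N2 \<noteq> 0" "complex_of_real N2 - 1 \<noteq> 0"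
    using N2 by simp_all
  have a2sq: "(a 2)\<^sup>2 = of_real ((b 1)\<^sup>2 / (E * (N2 - 1))) * w1\<^sup>2"
    by (simp add: a2 E_def power_mult_distrib power_divide power2_eq_square mult_ac)
  have "of_real D * a 3 = of_real (b 1) * w2 + of_real (b 2 + (b 1)\<^sup>2 / (N2 - 1)) * w1\<^sup>2"
    unfolding D_def a3' a2 using N2c by (simp add: field_simps power2_eq_square)
  then have "of_real D * (a 3 - of_real \<mu> * (a 2)\<^sup>2) = of_real (b 1) * w2 +
      (of_real (b 2 + (b 1)\<^sup>2 / (N2 - 1)) - of_real (D * \<mu> * ((b 1)\<^sup>2 / (E * (N2 - 1))))) * w1\<^sup>2"
    by (simp add: a2sq algebra_simps)
  also have "of_real (b 2 + (b 1)\<^sup>2 / (N2 - 1)) - of_real (D * \<mu> * ((b 1)\<^sup>2 / (E * (N2 - 1))))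
      = complex_of_real T"
    unfolding of_real_diff[symmetric] of_real_eq_iff T_def
      right_diff_distrib[of "(b 1)\<^sup>2 / (N2 - 1)"]
    by (simp add: mult_ac)
  finally have FS_eq: "of_real D * (a 3 - of_real \<mu> * (a 2)\<^sup>2) = of_real (b 1) * w2 + of_real T * w1\<^sup>2" .
  have "D * norm (a 3 - of_real \<mu> * (a 2)\<^sup>2) = norm (of_real (b 1) * w2 + of_real T * w1\<^sup>2)"
    unfolding FS_eq[symmetric] using D by (simp add: norm_mult)
  also have "\<dots> \<le> b 1 * norm w2 + \<bar>T\<bar> * x"
    using b(1) by (intro order.trans[OF norm_triangle_ineq]) (simp add: norm_mult norm_power x_def)
  also have "\<dots> \<le> b 1 * (1 - x) + \<bar>T\<bar> * x"
    using w2 b(1) by (simp add: x_def)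
  finally have FS: "D * norm (a 3 - of_real \<mu> * (a 2)\<^sup>2) \<le> b 1 * (1 - x) + \<bar>T\<bar> * x" .
  have norm_a2: "(norm (a 2))\<^sup>2 = (b 1)\<^sup>2 / (N2\<^sup>2 * (N2 - 1)\<^sup>2) * x"
    unfolding a2 norm_mult norm_of_real x_def by (simp add: power_mult_distrib power_divide)
  \<comment> \<open>The prefactor in the refined estimates is chosen to cancel the factor relating
    |a_2|^2 to \<open>x\<close>.\<close>
  have coeff: "N2\<^sup>2 * (N2 - 1)\<^sup>2 / (D * (b 1)\<^sup>2) * s * (norm (a 2))\<^sup>2 = s * x / D" for s
    unfolding norm_a2 using N2 b(1) D by (simp add: field_simps)
  \<comment> \<open>With \<open>s\<close> equal to b_2 - b_1, b_2 + b_1 and b_2 this covers \<rho>1,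
    \<rho>2 and \<rho>3. Comparing \<mu> with them thus amounts to the signs of T - b_1, T + b_1 and
    T.\<close>
  have rho: "(N2\<^sup>2 * (N2 - 1) * (b 1)\<^sup>2 + (N2 * (N2 - 1))\<^sup>2 * s) / (D * (b 1)\<^sup>2)
      = \<mu> + (T - b 2 + s) * (E * (N2 - 1) / (D * (b 1)\<^sup>2))" for s
  proof -
    have "T - b 2 + s = ((b 1)\<^sup>2 * E + s * E * (N2 - 1) - (b 1)\<^sup>2 * D * \<mu>) / (E * (N2 - 1))"
      using E K by (simp add: T_def field_simps)
    then have "(T - b 2 + s) * (E * (N2 - 1) / (D * (b 1)\<^sup>2))
        = ((b 1)\<^sup>2 * E + s * E * (N2 - 1) - (b 1)\<^sup>2 * D * \<mu>) / (D * (b 1)\<^sup>2)"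
      using E K by simp
    also have "\<dots> = ((b 1)\<^sup>2 * E + s * E * (N2 - 1)) / (D * (b 1)\<^sup>2) - \<mu>"
      using D b(1) by (simp add: field_simps)
    also have "(b 1)\<^sup>2 * E + s * E * (N2 - 1)
        = N2\<^sup>2 * (N2 - 1) * (b 1)\<^sup>2 + (N2 * (N2 - 1))\<^sup>2 * s"
      by (simp add: E_def power2_eq_square mult_ac)
    finally show ?thesis
      by simp
  qed
  define k where "k = E * (N2 - 1) / (D * (b 1)\<^sup>2)"
  have k: "k > 0"
    unfolding k_def using E K D b(1) by simp
  have compare: "\<mu> \<le> \<mu> + s * k \<longleftrightarrow> 0 \<le> s" "\<mu> + s * k \<le> \<mu> \<longleftrightarrow> s \<le> 0"
    "\<mu> < \<mu> + s * k \<longleftrightarrow> 0 < s" "\<mu> + s * k < \<mu> \<longleftrightarrow> s < 0" for s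
    using k by (simp_all add: zero_le_mult_iff mult_le_0_iff zero_less_mult_iff mult_less_0_iff)
  have RHS: "b 2 / D + (b 1)\<^sup>2 / (N2 - 1) * (1 / D - \<mu> / E) = T / D"
    "- b 2 / D - (b 1)\<^sup>2 / (N2 - 1) * (1 / D - \<mu> / E) = - T / D"
    unfolding T_def using D E K by (simp_all add: field_simps)
  have S: "b 1 - b 2 - (b 1)\<^sup>2 / (N2 - 1) * (1 - D / E * \<mu>) = b 1 - T"
    "b 1 + b 2 + (b 1)\<^sup>2 / (N2 - 1) * (1 - D / E * \<mu>) = b 1 + T"
    by (simp_all add: T_def)
  \<comment> \<open>A convex combination of b_1 and |T|; the three cases of the main bound decide
    which of the two is larger.\<close>
  have interp: "b 1 * (1 - x) + \<bar>T\<bar> * x \<le> max (b 1) \<bar>T\<bar>"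
    using x convex_bound_le[of "b 1" "max (b 1) \<bar>T\<bar>" "\<bar>T\<bar>" "1 - x" x] by (simp add: mult.commute)
  let ?FS = "norm (a 3 - of_real \<mu> * (a 2)\<^sup>2)"
  have 1: "?FS \<le> T / D" if "b 1 \<le> T"
    using FS interp that b(1) D by (simp add: field_simps)
  have 2: "?FS \<le> b 1 / D" if "- b 1 \<le> T" "T \<le> b 1"
    using FS interp that b(1) D by (simp add: field_simps)
  have 3: "?FS \<le> - T / D" if "T \<le> - b 1"
    using FS interp that b(1) D by (simp add: field_simps)
  have FS': "?FS \<le> (b 1 * (1 - x) + \<bar>T\<bar> * x) / D"
    using FS D by (simp add: pos_le_divide_eq mult.commute)
  \<comment> \<open>Here |T| = T, so b_1(1 - x) + |T|x = b_1 - (b_1 - T)x: the added term is the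
    slack lost in passing to the maximum. For T \<le> 0 it becomes (b_1 + T)x.\<close>
  have 4: "?FS + (b 1 - T) * x / D \<le> b 1 / D" if "0 \<le> T"
    using FS' that by (simp add: algebra_simps add_divide_distrib diff_divide_distrib)
  have 5: "?FS + (b 1 + T) * x / D \<le> b 1 / D" if "T \<le> 0"
    using FS' that by (simp add: algebra_simps add_divide_distrib diff_divide_distrib)
  show ?thesis
    \<comment> \<open>\<open>E\<close> is folded only after \<open>rho\<close> is applied, because
      the left side of \<open>rho\<close> contains its expanded form.\<close>
    unfolding Let_def N2_def[symmetric] N3_def[symmetric] D_def[symmetric]
    unfolding rho k_def[symmetric] compare
    unfolding E_def[symmetric] RHS S coeff
    using 1 2 3 4 5 by auto
qed

end
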